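(* Every latin square has a $2$-weight, and every latin square of odd order has a $1$-weight.
   Context: A latin square of order $n$ is an $n\times n$ array each of whose cells contains a symbol from a fixed $n$-set such that no symbol appears twice in any row or column. It is identified with the set $L$ of triples $(x,y,z)$ such that the cell in row $x$ and column $y$ contains symbol $z$; with rows, columns and symbols labelled by $[n]=\{1,\dots,n\}$ one has $L\subset[n]^3$. For $k\in\mathbb{Z}$, a $k$-weight of $L$ is a function $\theta:L\to\mathbb{Z}$ (an integral weight function on the cells, with negative values allowed) whose sum over each row, each column, and each symbol is $k$. That is, for each index $i$, $$\sum_{(r,c,i)\in L}\theta(r,c,i)=\sum_{(r,i,s)\in L}\theta(r,i,s)=\sum_{(i,c,s)\in L}\theta(i,c,s)=k.$$ *)

theory Defs
  imports Main
begin

(* The array A has order n; only its entries with both indices in {1..n} are relevant. *)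
definition latin_square :: "nat \<Rightarrow> (nat \<Rightarrow> nat \<Rightarrow> nat) \<Rightarrow> bool" where
  "latin_square n A \<longleftrightarrow>
     (\<forall>r\<in>{1..n}. \<forall>c\<in>{1..n}. A r c \<in> {1..n}) \<and>
     (\<forall>r\<in>{1..n}. inj_on (\<lambda>c. A r c) {1..n}) \<and>
     (\<forall>c\<in>{1..n}. inj_on (\<lambda>r. A r c) {1..n})"

definition triples :: "nat \<Rightarrow> (nat \<Rightarrow> nat \<Rightarrow> nat) \<Rightarrow> (nat \<times> nat \<times> nat) set" where
  "triples n A = {(r, c, s). r \<in> {1..n} \<and> c \<in> {1..n} \<and> s = A r c}"

(* A weight is a total function on triples, but only its values on L enter the sums. *)
definition is_weight ::
    "nat \<Rightarrow> (nat \<times> nat \<times> nat) set \<Rightarrow> int \<Rightarrow> (nat \<times> nat \<times> nat \<Rightarrow> int) \<Rightarrow> bool" where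
  "is_weight n L k \<theta> \<longleftrightarrow>
     (\<forall>i\<in>{1..n}.
        (\<Sum>t\<in>{(r, c, s) \<in> L. s = i}. \<theta> t) = k \<and>
        (\<Sum>t\<in>{(r, c, s) \<in> L. c = i}. \<theta> t) = k \<and>
        (\<Sum>t\<in>{(r, c, s) \<in> L. r = i}. \<theta> t) = k)"

end

theory Submission
  imports Defs
begin

text \<open>
  Call a row, a column or a symbol class of \<open>L\<close> a line. Every line has \<open>n\<close> cells, and two lines of
  different kinds share exactly one cell. A 2-weight can therefore be written down: pick any cell
  \<open>t0\<close>, add up the indicator functions of the three lines through \<open>t0\<close>, and subtract \<open>n\<close> at \<open>t0\<close>.
  A line that misses \<open>t0\<close> is disjoint from the line of its own kind through \<open>t0\<close> and meets the other
  two once each, so its sum is \<open>2\<close>. A line through \<open>t0\<close> receives an extra \<open>n\<close> from its own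
  indicator, and the correction at \<open>t0\<close> cancels it.

  The constant function \<open>1\<close> is an \<open>n\<close>-weight and integral weights are closed under integral linear
  combinations. For \<open>n = 2 * m + 1\<close>, the all-ones weight minus \<open>m\<close> times a 2-weight is a 1-weight.
\<close>

definition row_line :: "(nat \<times> nat \<times> nat) set \<Rightarrow> nat \<Rightarrow> (nat \<times> nat \<times> nat) set" where
  "row_line L i = {(r, c, s) \<in> L. r = i}"

definition col_line :: "(nat \<times> nat \<times> nat) set \<Rightarrow> nat \<Rightarrow> (nat \<times> nat \<times> nat) set" where
  "col_line L i = {(r, c, s) \<in> L. c = i}"

definition sym_line :: "(nat \<times> nat \<times> nat) set \<Rightarrow> nat \<Rightarrow> (nat \<times> nat \<times> nat) set" where
  "sym_line L i = {(r, c, s) \<in> L. s = i}"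

lemma is_weight_iff_line_sums:
  "is_weight n L k \<theta> \<longleftrightarrow>
     (\<forall>i\<in>{1..n}. sum \<theta> (sym_line L i) = k \<and> sum \<theta> (col_line L i) = k \<and> sum \<theta> (row_line L i) = k)"
  by (simp add: is_weight_def row_line_def col_line_def sym_line_def)

lemma finite_triples: "finite (triples n A)"
proof (rule finite_subset)
  show "triples n A \<subseteq> (\<lambda>(r, c). (r, c, A r c)) ` ({1..n} \<times> {1..n})"
    by (auto simp: triples_def)
qed simp

lemma finite_lines [simp]:
  "finite (row_line (triples n A) i)"
  "finite (col_line (triples n A) i)"
  "finite (sym_line (triples n A) i)"
  by (auto intro: finite_subset [OF _ finite_triples]
      simp: row_line_def col_line_def sym_line_def)

lemma card_row_col:
  assumes "i \<in> {1..n}" "j \<in> {1..n}"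
  shows "card (row_line (triples n A) i \<inter> col_line (triples n A) j) = 1"
proof -
  have "row_line (triples n A) i \<inter> col_line (triples n A) j = {(i, j, A i j)}"
    using assms by (auto simp: row_line_def col_line_def triples_def)
  then show ?thesis by simp
qed

text \<open>
  The entries of a row are \<open>n\<close> distinct elements of an \<open>n\<close>-set, so every symbol occurs in the row;
  likewise for columns.
\<close>

lemma card_row_sym:
  assumes L: "latin_square n A" and i: "i \<in> {1..n}" and s: "s \<in> {1..n}"
  shows "card (row_line (triples n A) i \<inter> sym_line (triples n A) s) = 1"
proof -
  have inj: "inj_on (A i) {1..n}" and "A i ` {1..n} \<subseteq> {1..n}"
    using L i unfolding latin_square_def by auto
  then have "A i ` {1..n} = {1..n}"
    by (intro endo_inj_surj) auto
  then obtain c where c: "c \<in> {1..n}" "A i c = s"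
    using s by (metis imageE)
  have "row_line (triples n A) i \<inter> sym_line (triples n A) s = {(i, c, s)}"
    using i c inj by (auto simp: row_line_def sym_line_def triples_def dest: inj_onD)
  then show ?thesis by simp
qed

lemma card_col_sym:
  assumes L: "latin_square n A" and i: "i \<in> {1..n}" and s: "s \<in> {1..n}"
  shows "card (col_line (triples n A) i \<inter> sym_line (triples n A) s) = 1"
proof -
  have inj: "inj_on (\<lambda>r. A r i) {1..n}" and "(\<lambda>r. A r i) ` {1..n} \<subseteq> {1..n}"
    using L i unfolding latin_square_def by auto
  then have "(\<lambda>r. A r i) ` {1..n} = {1..n}"
    by (intro endo_inj_surj) auto
  then obtain r where r: "r \<in> {1..n}" "A r i = s"
    using s by (metis (no_types, lifting) imageE)
  have "col_line (triples n A) i \<inter> sym_line (triples n A) s = {(r, i, s)}"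
    using i r inj by (auto simp: col_line_def sym_line_def triples_def dest: inj_onD)
  then show ?thesis by simp
qed

text \<open>
  The \<open>n\<close> lines of another kind partition the cells, and each of them meets the given line once;
  so the size of a line follows from the intersection numbers.
\<close>

lemma card_row_line:
  assumes "i \<in> {1..n}"
  shows "card (row_line (triples n A) i) = n"
proof -
  have "row_line (triples n A) i =
      (\<Union>j\<in>{1..n}. row_line (triples n A) i \<inter> col_line (triples n A) j)"
    by (auto simp: row_line_def col_line_def triples_def)
  also have "card \<dots> = (\<Sum>j\<in>{1..n}. card (row_line (triples n A) i \<inter> col_line (triples n A) j))"
    by (rule card_UN_disjoint) (auto simp: col_line_def)
  also have "\<dots> = (\<Sum>j\<in>{1..n}. 1)"
    using assms by (intro sum.cong refl card_row_col) auto
  finally show ?thesis by simp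
qed

lemma card_col_line:
  assumes "j \<in> {1..n}"
  shows "card (col_line (triples n A) j) = n"
proof -
  have "col_line (triples n A) j =
      (\<Union>i\<in>{1..n}. row_line (triples n A) i \<inter> col_line (triples n A) j)"
    by (auto simp: row_line_def col_line_def triples_def)
  also have "card \<dots> = (\<Sum>i\<in>{1..n}. card (row_line (triples n A) i \<inter> col_line (triples n A) j))"
    by (rule card_UN_disjoint) (auto simp: row_line_def)
  also have "\<dots> = (\<Sum>i\<in>{1..n}. 1)"
    using assms by (intro sum.cong refl card_row_col) auto
  finally show ?thesis by simp
qed

lemma card_sym_line:
  assumes "latin_square n A" "s \<in> {1..n}"
  shows "card (sym_line (triples n A) s) = n"
proof -
  have "sym_line (triples n A) s =
      (\<Union>i\<in>{1..n}. row_line (triples n A) i \<inter> sym_line (triples n A) s)"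
    by (auto simp: row_line_def sym_line_def triples_def)
  also have "card \<dots> = (\<Sum>i\<in>{1..n}. card (row_line (triples n A) i \<inter> sym_line (triples n A) s))"
    by (rule card_UN_disjoint) (auto simp: row_line_def)
  also have "\<dots> = (\<Sum>i\<in>{1..n}. 1)"
    using assms by (intro sum.cong refl card_row_sym) auto
  finally show ?thesis by simp
qed

text \<open>
  In the application \<open>X0\<close>, \<open>Y0\<close>, \<open>Z0\<close> are the three lines through \<open>t0\<close>, and \<open>X\<close> is any line of the
  same kind as \<open>X0\<close>. Stating this for abstract sets lets rows, columns and symbols share one proof.
\<close>

lemma sum_line_indicators:
  fixes t0 :: 'a and n :: nat
  assumes "finite X" and "t0 \<in> X0" and "card X0 = n"
    and parallel: "X = X0 \<or> X \<inter> X0 = {}"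
    and "card (X \<inter> Y0) = 1" and "card (X \<inter> Z0) = 1"
  shows "(\<Sum>t\<in>X. of_bool (t \<in> X0) + of_bool (t \<in> Y0) + of_bool (t \<in> Z0)
            - int n * of_bool (t = t0)) = 2"
proof -
  have "(\<Sum>t\<in>X. of_bool (t \<in> X0) + of_bool (t \<in> Y0) + of_bool (t \<in> Z0)
            - int n * of_bool (t = t0))
      = int (card (X \<inter> X0)) + int (card (X \<inter> Y0)) + int (card (X \<inter> Z0))
          - int n * int (card (X \<inter> {t0}))"
    using assms(1)
    by (simp add: sum.distrib sum_subtractf sum_distrib_left [symmetric] sum_of_bool_eq
        Int_def)
  also have "\<dots> = 2"
    using parallel
  proof
    assume "X = X0"
    then show ?thesis using assms by simp
  next
    assume "X \<inter> X0 = {}"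
    moreover from this have "X \<inter> {t0} = {}" using \<open>t0 \<in> X0\<close> by auto
    ultimately show ?thesis using assms by simp
  qed
  finally show ?thesis .
qed

lemma latin_square_has_2_weight:
  assumes L: "latin_square n A"
  shows "\<exists>\<theta>. is_weight n (triples n A) 2 \<theta>"
proof (cases "n = 0")
  case True
  then show ?thesis by (simp add: is_weight_def)
next
  case False
  define T where "T = triples n A"
  define s0 where "s0 = A 1 1"
  \<comment> \<open>The base cell is arbitrary; a nonempty square has the cell in row 1 and column 1.\<close>
  define t0 where "t0 = (1::nat, 1::nat, s0)"
  define R where "R = row_line T 1"
  define C where "C = col_line T 1"
  define S where "S = sym_line T s0"
  define \<theta> where "\<theta> = (\<lambda>t. of_bool (t \<in> R) + of_bool (t \<in> C) + of_bool (t \<in> S)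
                          - int n * of_bool (t = t0))"
  have one: "1 \<in> {1..n}" using False by simp
  then have s0: "s0 \<in> {1..n}"
    using L unfolding latin_square_def s0_def by blast
  have t0: "t0 \<in> R" "t0 \<in> C" "t0 \<in> S"
    using one by (auto simp: R_def C_def S_def T_def t0_def s0_def
        row_line_def col_line_def sym_line_def triples_def)
  have "sum \<theta> (sym_line T i) = 2 \<and> sum \<theta> (col_line T i) = 2 \<and> sum \<theta> (row_line T i) = 2"
    if i: "i \<in> {1..n}" for i
  proof (intro conjI)
    have "sum \<theta> (row_line T i) = (\<Sum>t\<in>row_line T i. of_bool (t \<in> R) + of_bool (t \<in> C)
        + of_bool (t \<in> S) - int n * of_bool (t = t0))"
      by (simp add: \<theta>_def)
    also have "\<dots> = 2"
    proof (rule sum_line_indicators)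
      show "row_line T i = R \<or> row_line T i \<inter> R = {}"
        by (auto simp: R_def row_line_def)
    qed (use t0 one s0 i L in \<open>auto simp: R_def C_def S_def T_def card_row_line
        intro!: card_row_col [simplified] card_row_sym [simplified]\<close>)
    finally show "sum \<theta> (row_line T i) = 2" .
    have "sum \<theta> (col_line T i) = (\<Sum>t\<in>col_line T i. of_bool (t \<in> C) + of_bool (t \<in> R)
        + of_bool (t \<in> S) - int n * of_bool (t = t0))"
      by (simp add: \<theta>_def algebra_simps)
    also have "\<dots> = 2"
    proof (rule sum_line_indicators)
      show "col_line T i = C \<or> col_line T i \<inter> C = {}"
        by (auto simp: C_def col_line_def)
      show "card (col_line T i \<inter> R) = 1"
        using card_row_col [OF one i] by (simp add: R_def T_def Int_commute)
    qed (use t0 one s0 i L in \<open>auto simp: R_def C_def S_def T_def card_col_line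
        intro!: card_col_sym [simplified]\<close>)
    finally show "sum \<theta> (col_line T i) = 2" .
    have "sum \<theta> (sym_line T i) = (\<Sum>t\<in>sym_line T i. of_bool (t \<in> S) + of_bool (t \<in> R)
        + of_bool (t \<in> C) - int n * of_bool (t = t0))"
      by (simp add: \<theta>_def algebra_simps)
    also have "\<dots> = 2"
    proof (rule sum_line_indicators)
      show "sym_line T i = S \<or> sym_line T i \<inter> S = {}"
        by (auto simp: S_def sym_line_def)
      show "card (sym_line T i \<inter> R) = 1"
        using card_row_sym [OF L one i] by (simp add: R_def T_def Int_commute)
      show "card (sym_line T i \<inter> C) = 1"
        using card_col_sym [OF L one i] by (simp add: C_def T_def Int_commute)
      show "card S = n"
        using card_sym_line [OF L s0] by (simp add: S_def T_def)
    qed (use t0 in \<open>auto simp: T_def\<close>)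
    finally show "sum \<theta> (sym_line T i) = 2" .
  qed
  then have "is_weight n T 2 \<theta>"
    by (simp add: is_weight_iff_line_sums)
  then show ?thesis unfolding T_def by blast
qed

lemma is_weight_all_ones:
  assumes "latin_square n A"
  shows "is_weight n (triples n A) (int n) (\<lambda>_. 1)"
  using assms
  by (auto simp: is_weight_iff_line_sums card_row_line card_col_line card_sym_line)

lemma is_weight_diff_scaled:
  assumes "is_weight n L k \<theta>" and "is_weight n L l \<phi>"
  shows "is_weight n L (k - m * l) (\<lambda>t. \<theta> t - m * \<phi> t)"
  using assms
  by (simp add: is_weight_iff_line_sums sum_subtractf sum_distrib_left [symmetric])

theorem theorem3:
  fixes n :: nat and A :: "nat \<Rightarrow> nat \<Rightarrow> nat"
  assumes "latin_square n A"
  shows "(\<exists>\<theta>. is_weight n (triples n A) 2 \<theta>) \<and>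
         (odd n \<longrightarrow> (\<exists>\<theta>. is_weight n (triples n A) 1 \<theta>))"
proof (intro conjI impI)
  show two: "\<exists>\<theta>. is_weight n (triples n A) 2 \<theta>"
    using assms by (rule latin_square_has_2_weight)
  assume "odd n"
  then obtain m where m: "n = 2 * m + 1" by (rule oddE)
  obtain \<theta> where "is_weight n (triples n A) 2 \<theta>" using two by blast
  from is_weight_diff_scaled [OF is_weight_all_ones [OF assms] this, of "int m"]
  have "is_weight n (triples n A) 1 (\<lambda>t. 1 - int m * \<theta> t)"
    by (simp add: m)
  then show "\<exists>\<theta>. is_weight n (triples n A) 1 \<theta>" by blast
qed

end
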